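(* Suppose $\phi,\psi\colon[\omega]^\omega\to[\omega]^\omega$ are maps such that: (a) the family $\psi([\omega]^\omega)=\{\psi(B):B\in[\omega]^\omega\}$ is centered, and (b) for all $A,B\in[\omega]^\omega$, if $A\subseteq^*\psi(B)$ then $B$ does not split $\phi(A)$. Then $\phi$ and $\psi$ are not both Borel.
   Context: $[\omega]^\omega$ is the space of infinite subsets of $\omega$, a Polish space as a $G_\delta$ subspace of $2^\omega$. $A\subseteq^* B$ means $A\setminus B$ is finite. A family is centered if every finite subfamily has infinite intersection. A set $B\subseteq\omega$ splits an infinite set $X\subseteq\omega$ if both $X\cap B$ and $X\setminus B$ are infinite. *)

theory Defs
  imports "HOL-Analysis.Analysis"
begin

definition infsets :: "nat set set" where
  "infsets = {A. infinite A}"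

(* The subspace topology inherited from the Cantor space 2^omega (countable product of the
   discrete two-point space), a set being identified with its characteristic function. *)
definition infsets_topology :: "nat set topology" where
  "infsets_topology =
     pullback_topology infsets (\<lambda>A n. n \<in> A)
       (product_topology (\<lambda>_::nat. discrete_topology (UNIV :: bool set)) UNIV)"

definition infsets_borel :: "nat set measure" where
  "infsets_borel = sigma infsets {U. openin infsets_topology U}"

definition almost_subset :: "nat set \<Rightarrow> nat set \<Rightarrow> bool" where
  "almost_subset A B \<longleftrightarrow> finite (A - B)"

(* The empty subfamily is harmless: its intersection is UNIV, which is infinite. *)
definition centered :: "nat set set \<Rightarrow> bool" where
  "centered \<F> \<longleftrightarrow> (\<forall>\<G>. finite \<G> \<and> \<G> \<subseteq> \<F> \<longrightarrow> infinite (\<Inter>\<G>))"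

definition splits :: "nat set \<Rightarrow> nat set \<Rightarrow> bool" where
  "splits B X \<longleftrightarrow> infinite (X \<inter> B) \<and> infinite (X - B)"

lemma topspace_infsets_topology: "topspace infsets_topology = infsets"
  by (simp add: infsets_topology_def topspace_pullback_topology)

lemma space_infsets_borel: "space infsets_borel = infsets"
  unfolding infsets_borel_def
  by (rule space_measure_of)
     (use openin_subset topspace_infsets_topology in blast)

lemma sets_infsets_borel:
  "sets infsets_borel = sigma_sets infsets {U. openin infsets_topology U}"
  unfolding infsets_borel_def
  by (rule sets_measure_of)
     (use openin_subset topspace_infsets_topology in blast)

end

theory Submission
  imports Defs
begin

text \<open>
  Let \<open>F\<close> be the filter generated by the range of \<open>\<psi>\<close>, and work with the boxes
  \<open>[s, K] = {A. s \<subseteq> A \<subseteq> K}\<close>, where \<open>s\<close> is finite and \<open>K \<in> F\<close>. They are the conditions of the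
  Mathias--Prikry forcing of \<open>F\<close>: they form a Baire category base in which boxes with
  the same stem \<open>s\<close> meet, and Borel sets have the Baire property. By hypothesis (b), for
  every \<open>A \<in> [{}, \<psi> B]\<close> the set \<open>\<phi> A\<close> is almost contained in \<open>B\<close> or in its complement, so some box
  \<open>[s, G]\<close> decides which one, together with the finite error. Since \<open>F\<close> is generated by a
  Borel image and forcing a Borel statement is a Borel relation in \<open>G\<close>, the set
  of all \<open>B\<close> decided in a given way with a given stem \<open>s\<close> is analytic. Countably many such
  sets cover everything, so one is nonmeager, and being analytic it contains two
  sets that are complementary up to a finite set. The corresponding two boxes have the same stem, hence
  meet, and on their intersection \<open>\<phi> A\<close> is finite for almost all \<open>A\<close>, which is absurd. This is the argument
  of Judah and Shelah that Suslin ccc forcing adds no real unsplit by the ground model.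
\<close>

section \<open>Category relative to a base\<close>

text \<open>No topology is fixed; category is read off the base alone. \<open>linked\<close> is a
  sigma-linked form of the countable chain condition. \<open>D n\<close> plays the role of "diameter
  below 1/n" in the Baire category theorem: only sequences that run through all \<open>D n\<close>
  must have a common point.\<close>

locale category_base =
  fixes base :: "'a set set" and idx :: "'a set \<Rightarrow> nat" and D :: "nat \<Rightarrow> 'a set set"
  assumes base_Int: "\<lbrakk>V \<in> base; W \<in> base; V \<inter> W \<noteq> {}\<rbrakk> \<Longrightarrow> V \<inter> W \<in> base"
    and linked: "\<lbrakk>V \<in> base; W \<in> base; idx V = idx W\<rbrakk> \<Longrightarrow> V \<inter> W \<noteq> {}"
    and dense: "V \<in> base \<Longrightarrow> \<exists>W\<in>base \<inter> D n. W \<subseteq> V"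
    and complete: "\<lbrakk>\<And>n. U n \<in> base \<inter> D n; decseq U\<rbrakk> \<Longrightarrow> (\<Inter>n. U n) \<noteq> {}"
begin

definition nwd :: "'a set \<Rightarrow> bool" where
  "nwd M \<longleftrightarrow> (\<forall>V\<in>base. \<exists>W\<in>base. W \<subseteq> V \<and> W \<inter> M = {})"

definition meager :: "'a set \<Rightarrow> bool" where
  "meager M \<longleftrightarrow> (\<exists>N :: nat \<Rightarrow> 'a set. (\<forall>n. nwd (N n)) \<and> M \<subseteq> (\<Union>n. N n))"

lemma meager_subset: "meager M \<Longrightarrow> M' \<subseteq> M \<Longrightarrow> meager M'"
  unfolding meager_def by blast

lemma nwd_imp_meager: "nwd M \<Longrightarrow> meager M"
  unfolding meager_def by (rule exI[of _ "\<lambda>_. M"]) auto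

lemma meager_empty: "meager {}"
  by (rule nwd_imp_meager) (auto simp: nwd_def)

lemma meager_UN_nat:
  fixes M :: "nat \<Rightarrow> 'a set"
  assumes "\<And>n. meager (M n)"
  shows "meager (\<Union>n. M n)"
proof -
  obtain N :: "nat \<Rightarrow> nat \<Rightarrow> 'a set"
    where N: "\<And>n k. nwd (N n k)" "\<And>n. M n \<subseteq> (\<Union>k. N n k)"
    using assms unfolding meager_def by metis
  show ?thesis
    unfolding meager_def
  proof (intro exI[of _ "\<lambda>i. case prod_decode i of (n, k) \<Rightarrow> N n k"] conjI allI subsetI)
    fix x assume "x \<in> (\<Union>n. M n)"
    then obtain n k where "x \<in> N n k" using N(2) by blast
    then show "x \<in> (\<Union>i. case prod_decode i of (n, k) \<Rightarrow> N n k)"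
      by (auto intro!: exI[of _ "prod_encode (n, k)"])
  qed (auto simp: N(1) split: prod.split)
qed

lemma meager_UN:
  assumes "countable I" "\<And>i. i \<in> I \<Longrightarrow> meager (M i)"
  shows "meager (\<Union>i\<in>I. M i)"
proof (cases "I = {}")
  case False
  then have "(\<Union>i\<in>I. M i) = (\<Union>n. M (from_nat_into I n))"
    using assms(1) by (metis UN_extend_simps(10) range_from_nat_into)
  then show ?thesis
    using False assms(2) by (simp add: from_nat_into meager_UN_nat)
qed (simp add: meager_empty)

lemma meager_Un: "meager M \<Longrightarrow> meager M' \<Longrightarrow> meager (M \<union> M')"
  using meager_UN[of "{True, False}" "\<lambda>b. if b then M else M'"] by (auto simp: Un_commute)

text \<open>Banach's category theorem: choosing one meager piece for each index suffices,
  because any two base sets with the same index meet.\<close>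

lemma meager_if_locally_meager:
  assumes loc: "\<And>V. V \<in> base \<Longrightarrow> \<exists>W\<in>base. W \<subseteq> V \<and> meager (M \<inter> W)"
  shows "meager M"
proof -
  define ok where "ok n V \<longleftrightarrow> V \<in> base \<and> idx V = n \<and> meager (M \<inter> V)" for n V
  define J where "J = {n. \<exists>V. ok n V}"
  define V where "V n = (SOME V. ok n V)" for n
  have V: "ok n (V n)" if "n \<in> J" for n
    using that someI_ex unfolding J_def V_def by force
  have "nwd (M - (\<Union>n\<in>J. V n))"
    unfolding nwd_def
  proof
    fix U assume "U \<in> base"
    then obtain W where W: "W \<in> base" "W \<subseteq> U" "meager (M \<inter> W)"
      using loc by blast
    then have J: "idx W \<in> J"
      unfolding J_def ok_def by blast
    then have "W \<inter> V (idx W) \<in> base"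
      using V[OF J] W(1) linked base_Int unfolding ok_def by metis
    then show "\<exists>W\<in>base. W \<subseteq> U \<and> W \<inter> (M - (\<Union>n\<in>J. V n)) = {}"
      using W(2) J by (intro bexI[of _ "W \<inter> V (idx W)"]) auto
  qed
  moreover have "meager (\<Union>n\<in>J. M \<inter> V n)"
    using V unfolding ok_def by (intro meager_UN) auto
  ultimately have "meager ((M - (\<Union>n\<in>J. V n)) \<union> (\<Union>n\<in>J. M \<inter> V n))"
    by (metis meager_Un nwd_imp_meager)
  then show ?thesis
    by (rule meager_subset) auto
qed

lemma meager_Int_if_locally_meager:
  assumes V: "V \<in> base"
    and loc: "\<And>W. W \<in> base \<Longrightarrow> W \<subseteq> V \<Longrightarrow> \<exists>W'\<in>base. W' \<subseteq> W \<and> meager (M \<inter> W')"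
  shows "meager (M \<inter> V)"
proof (rule meager_if_locally_meager)
  fix W assume W: "W \<in> base"
  show "\<exists>W'\<in>base. W' \<subseteq> W \<and> meager (M \<inter> V \<inter> W')"
  proof (cases "W \<inter> V = {}")
    case True
    then have "M \<inter> V \<inter> W = {}" by auto
    then show ?thesis using W meager_empty by (intro bexI[of _ W]) simp_all
  next
    case False
    then have "W \<inter> V \<in> base" using W V base_Int by simp
    then obtain W' where "W' \<in> base" "W' \<subseteq> W \<inter> V" "meager (M \<inter> W')"
      using loc by (metis inf_le2)
    then show ?thesis
      by (intro bexI[of _ W']) (auto intro: meager_subset)
  qed
qed

theorem baire:
  assumes "V \<in> base"
  shows "\<not> meager V"
proof
  assume "meager V"
  then obtain N :: "nat \<Rightarrow> 'a set" where N: "\<And>n. nwd (N n)" "V \<subseteq> (\<Union>n. N n)"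
    unfolding meager_def by blast
  \<comment> \<open>Avoid \<open>N n\<close> first and enter \<open>D n\<close> afterwards, which
    keeps both properties.\<close>
  have step: "\<exists>W'. W' \<in> base \<inter> D n \<and> W' \<subseteq> W \<and> W' \<inter> N n = {}" if W: "W \<in> base" for W n
  proof -
    obtain W1 where W1: "W1 \<in> base" "W1 \<subseteq> W" "W1 \<inter> N n = {}"
      using N(1)[of n] W unfolding nwd_def by blast
    obtain W' where "W' \<in> base \<inter> D n" "W' \<subseteq> W1"
      using dense[OF W1(1)] by blast
    then show ?thesis
      using W1 by blast
  qed
  have "\<exists>W. \<forall>n. (W n \<in> base \<inter> D n \<and> W n \<subseteq> V \<and> W n \<inter> N n = {}) \<and> W (Suc n) \<subseteq> W n"
  proof (rule dependent_nat_choice)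
    show "\<exists>W. W \<in> base \<inter> D 0 \<and> W \<subseteq> V \<and> W \<inter> N 0 = {}"
      using step assms by blast
  next
    fix W n assume "W \<in> base \<inter> D n \<and> W \<subseteq> V \<and> W \<inter> N n = {}"
    then show "\<exists>W'. (W' \<in> base \<inter> D (Suc n) \<and> W' \<subseteq> V \<and> W' \<inter> N (Suc n) = {}) \<and> W' \<subseteq> W"
      using step[of W "Suc n"] by blast
  qed
  then obtain W where W: "\<And>n. W n \<in> base \<inter> D n" "\<And>n. W n \<subseteq> V" "\<And>n. W n \<inter> N n = {}"
    and "\<And>n. W (Suc n) \<subseteq> W n"
    by blast
  then have "decseq W"
    by (simp add: decseq_Suc_iff)
  then obtain x where "x \<in> (\<Inter>n. W n)"
    using complete[OF W(1)] by blast
  then have x: "\<And>n. x \<in> W n" by blast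
  then have "x \<in> V" using W(2)[of 0] by blast
  then obtain n where "x \<in> N n" using N(2) by blast
  with x[of n] W(3)[of n] show False by blast
qed

text \<open>A hereditary form of nonmeagerness, suited to fusion: it passes to smaller base sets,
  and, after shrinking, to one of countably many pieces.\<close>

definition full :: "'a set \<Rightarrow> 'a set \<Rightarrow> bool" where
  "full A V \<longleftrightarrow> V \<in> base \<and> (\<forall>W\<in>base. W \<subseteq> V \<longrightarrow> \<not> meager (A \<inter> W))"

lemma full_mono: "full A V \<Longrightarrow> W \<in> base \<Longrightarrow> W \<subseteq> V \<Longrightarrow> full A W"
  unfolding full_def by blast

lemma full_Int_nonempty: "full A V \<Longrightarrow> A \<inter> V \<noteq> {}"
  unfolding full_def using meager_empty by (metis order_refl)

lemma ex_full_subset: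
  assumes "V \<in> base" "\<not> meager (A \<inter> V)"
  shows "\<exists>W. W \<subseteq> V \<and> full A W"
  using meager_Int_if_locally_meager[OF assms(1), of A] assms(2) unfolding full_def by blast

lemma ex_full:
  assumes "\<not> meager A"
  shows "\<exists>V. full A V"
  using meager_if_locally_meager[of A] assms unfolding full_def by blast

lemma full_UN:
  assumes "full (\<Union>n::nat. A n) V"
  shows "\<exists>n W. W \<subseteq> V \<and> full (A n) W"
proof -
  have "V \<in> base" "\<not> meager (\<Union>n. A n \<inter> V)"
    using assms unfolding full_def by auto
  then show ?thesis
    using meager_UN_nat ex_full_subset by metis
qed

text \<open>The local form of the Baire property. In forcing terms, densely many conditions decide
  whether the generic point lies in \<open>P\<close>.\<close>

definition decided :: "'a set \<Rightarrow> bool" where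
  "decided P \<longleftrightarrow> (\<forall>V\<in>base. \<exists>W\<in>base. W \<subseteq> V \<and> (meager (W \<inter> P) \<or> meager (W - P)))"

text \<open>If \<open>P\<close> were comeager in no base set below \<open>V\<close>, then being
  decided would make it meager densely often below \<open>V\<close>, hence meager in
  \<open>V\<close> by Banach's category theorem.\<close>

lemma ex_comeager_subset:
  assumes "decided P" "V \<in> base" "\<not> meager (P \<inter> V)"
  shows "\<exists>W\<in>base. W \<subseteq> V \<and> meager (W - P)"
proof (rule ccontr)
  assume neg: "\<not> ?thesis"
  have "meager (P \<inter> V)"
  proof (rule meager_Int_if_locally_meager[OF assms(2)])
    fix W assume "W \<in> base" "W \<subseteq> V"
    then show "\<exists>W'\<in>base. W' \<subseteq> W \<and> meager (P \<inter> W')"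
      using assms(1) neg unfolding decided_def by (metis Int_commute order_trans)
  qed
  with assms(3) show False ..
qed

lemma decided_UN:
  fixes P :: "nat \<Rightarrow> 'a set"
  assumes dec: "\<And>n. decided (P n)"
  shows "decided (\<Union>n. P n)"
  unfolding decided_def
proof
  fix V assume V: "V \<in> base"
  show "\<exists>W\<in>base. W \<subseteq> V \<and> (meager (W \<inter> (\<Union>n. P n)) \<or> meager (W - (\<Union>n. P n)))"
  proof (cases "\<forall>n. meager (P n \<inter> V)")
    case True
    then have "meager (\<Union>n. P n \<inter> V)"
      by (intro meager_UN_nat) simp
    then have "meager (V \<inter> (\<Union>n. P n))"
      by (rule meager_subset) auto
    then show ?thesis using V by blast
  next
    case False
    then obtain n W where "W \<in> base" "W \<subseteq> V" "meager (W - P n)"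
      using ex_comeager_subset[OF dec V] by blast
    moreover from this(3) have "meager (W - (\<Union>n. P n))"
      by (rule meager_subset) auto
    ultimately show ?thesis by blast
  qed
qed

lemma decided_sigma_sets:
  assumes "P \<in> sigma_sets \<Omega> \<G>" "\<Union>base \<subseteq> \<Omega>" "\<And>G. G \<in> \<G> \<Longrightarrow> decided G"
  shows "decided P"
  using assms(1)
proof induction
  case (Basic P)
  then show ?case by (rule assms(3))
next
  case Empty
  then show ?case using meager_empty by (auto simp: decided_def)
next
  case (Compl P)
  have "W - (\<Omega> - P) = W \<inter> P" "W \<inter> (\<Omega> - P) = W - P" if "W \<in> base" for W
    using that assms(2) by auto
  then show ?case
    using Compl.IH unfolding decided_def by metis
next
  case (Union P)
  then show ?case by (intro decided_UN)
qed

end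

section \<open>Analytic sets\<close>

definition analytic :: "'a::topological_space set \<Rightarrow> bool" where
  "analytic S \<longleftrightarrow> (\<exists>C :: ('a \<times> (nat \<Rightarrow> nat)) set. closed C \<and> S = fst ` C)"

lemma closed_imp_analytic: "closed S \<Longrightarrow> analytic S"
  unfolding analytic_def by (intro exI[of _ "S \<times> UNIV"]) (simp add: closed_Times)

lemma continuous_on_snd_coordinate:
  "continuous_on UNIV (\<lambda>p :: 'a::topological_space \<times> (nat \<Rightarrow> nat). snd p i)"
  by (rule continuous_on_product_then_coordinatewise[OF continuous_on_snd[OF continuous_on_id]])

lemma continuous_on_snd_reindex:
  "continuous_on UNIV (\<lambda>p :: 'a::topological_space \<times> (nat \<Rightarrow> nat). \<lambda>i. snd p (f i :: nat))"
  by (rule continuous_on_coordinatewise_then_product) (rule continuous_on_snd_coordinate)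

lemma continuous_on_fst_snd_reindex:
  "continuous_on UNIV (\<lambda>p :: 'a::topological_space \<times> (nat \<Rightarrow> nat). (fst p, \<lambda>i. snd p (f i :: nat)))"
  by (rule continuous_on_Pair[OF continuous_on_fst[OF continuous_on_id] continuous_on_snd_reindex])

lemma analytic_UN:
  assumes "\<And>n::nat. analytic (S n)"
  shows "analytic (\<Union>n. S n)"
proof -
  obtain C :: "nat \<Rightarrow> ('a \<times> (nat \<Rightarrow> nat)) set"
    where C: "\<And>n. closed (C n)" "\<And>n. S n = fst ` C n"
    using assms unfolding analytic_def by metis
  \<comment> \<open>Coordinate 0 of the witness selects one of the sets, and the shifted rest is a
    witness for it. Closedness survives because coordinate 0 takes discrete values.\<close>
  define E where "E = {p. (fst p, \<lambda>i. snd p (Suc i)) \<in> C (snd p 0)}"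
  have "- E = (\<Union>n. (\<lambda>p. snd p 0) -` {n} \<inter> (\<lambda>p. (fst p, \<lambda>i. snd p (Suc i))) -` (- C n))"
    by (auto simp: E_def)
  moreover have "open ((\<lambda>p::'a \<times> (nat \<Rightarrow> nat). snd p 0) -` {n})" for n
    by (rule open_vimage[OF open_discrete continuous_on_snd_coordinate])
  moreover have "open ((\<lambda>p::'a \<times> (nat \<Rightarrow> nat). (fst p, \<lambda>i. snd p (Suc i))) -` (- C n))" for n
    by (rule open_vimage[OF _ continuous_on_fst_snd_reindex]) (rule open_Compl[OF C(1)])
  ultimately have "open (- E)"
    by (metis (no_types, lifting) open_Int open_UN)
  then have "closed E"
    by (simp add: closed_def)
  moreover have "(\<Union>n. S n) = fst ` E"
  proof (intro equalityI subsetI)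
    fix x assume "x \<in> (\<Union>n. S n)"
    then obtain n w where "(x, w) \<in> C n"
      using C(2) by force
    then have "(x, case_nat n w) \<in> E"
      by (simp add: E_def)
    then show "x \<in> fst ` E" by force
  qed (force simp: E_def C(2))
  ultimately show ?thesis
    unfolding analytic_def by blast
qed

lemma analytic_INT:
  assumes "\<And>n::nat. analytic (S n)"
  shows "analytic (\<Inter>n. S n)"
proof -
  obtain C :: "nat \<Rightarrow> ('a \<times> (nat \<Rightarrow> nat)) set"
    where C: "\<And>n. closed (C n)" "\<And>n. S n = fst ` C n"
    using assms unfolding analytic_def by metis
  \<comment> \<open>One witness carries a witness for every \<open>S n\<close>, stored in row
    \<open>n\<close> of the pairing function.\<close>
  define E where "E = (\<Inter>n. (\<lambda>p. (fst p, \<lambda>i. snd p (prod_encode (n, i)))) -` C n)"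
  have "closed E"
    unfolding E_def
    by (intro closed_INT ballI closed_vimage[OF C(1)] continuous_on_fst_snd_reindex)
  moreover have "(\<Inter>n. S n) = fst ` E"
  proof (intro equalityI subsetI)
    fix x assume "x \<in> (\<Inter>n. S n)"
    then have "\<exists>w. (x, w) \<in> C n" for n
      using C(2) by force
    then obtain w where "\<And>n. (x, w n) \<in> C n"
      by metis
    then have "(x, \<lambda>i. w (fst (prod_decode i)) (snd (prod_decode i))) \<in> E"
      by (simp add: E_def)
    then show "x \<in> fst ` E" by force
  qed (force simp: E_def C(2))
  ultimately show ?thesis
    unfolding analytic_def by blast
qed

text \<open>On the Baire space and its square, which are zero-dimensional and second countable, this
  is the Borel sigma-algebra. Clopen generators make a set and its complement analytic at
  once.\<close>

definition clopen_borel :: "'a::topological_space measure" where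
  "clopen_borel = sigma UNIV {C. open C \<and> closed C}"

lemma space_clopen_borel [simp]: "space clopen_borel = UNIV"
  by (simp add: clopen_borel_def space_measure_of_conv)

lemma sets_clopen_borel: "sets clopen_borel = sigma_sets UNIV {C. open C \<and> closed C}"
  by (simp add: clopen_borel_def)

lemma clopen_in_clopen_borel: "open C \<Longrightarrow> closed C \<Longrightarrow> C \<in> sets clopen_borel"
  unfolding sets_clopen_borel by (rule sigma_sets.Basic) simp

lemma continuous_on_imp_measurable_clopen_borel:
  assumes "continuous_on UNIV f"
  shows "f \<in> clopen_borel \<rightarrow>\<^sub>M clopen_borel"
  by (rule measurable_sigma_sets[OF sets_clopen_borel])
     (auto intro!: clopen_in_clopen_borel open_vimage closed_vimage assms)

theorem clopen_borel_imp_analytic: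
  assumes "S \<in> sets clopen_borel"
  shows "analytic S"
proof -
  \<comment> \<open>Analytic sets are not closed under complement, so the induction carries both
    halves.\<close>
  have "analytic S \<and> analytic (- S)"
    using assms unfolding sets_clopen_borel
  proof induction
    case (Basic S)
    then show ?case by (simp add: closed_imp_analytic closed_Compl)
  next
    case (Compl S)
    then show ?case by (simp add: Compl_eq_Diff_UNIV[symmetric])
  next
    case (Union S)
    then show ?case
      using analytic_UN[of S] analytic_INT[of "\<lambda>n. - S n"] by simp
  qed (simp add: closed_imp_analytic)
  then show ?thesis ..
qed

lemma analytic_projection:
  fixes Q :: "('a::topological_space \<times> (nat \<Rightarrow> nat)) set"
  assumes "analytic Q"
  shows "analytic (fst ` Q)"
proof -
  obtain C :: "(('a \<times> (nat \<Rightarrow> nat)) \<times> (nat \<Rightarrow> nat)) set" where C: "closed C" "Q = fst ` C"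
    using assms unfolding analytic_def by blast
  \<comment> \<open>Two projections become one by interleaving: even coordinates hold the point
    projected away, odd ones the witness for membership in \<open>Q\<close>.\<close>
  define E where
    "E = (\<lambda>p. ((fst p, \<lambda>n. snd p (2 * n)), \<lambda>n. snd p (Suc (2 * n)))) -` C"
  have "closed E"
    unfolding E_def
    by (intro closed_vimage[OF C(1)] continuous_on_Pair continuous_on_fst_snd_reindex
        continuous_on_snd_reindex)
  moreover have "fst ` Q = fst ` E"
  proof (intro equalityI subsetI)
    fix x assume "x \<in> fst ` Q"
    then obtain w v where "((x, w), v) \<in> C"
      using C(2) by force
    then have "(x, \<lambda>n. if even n then w (n div 2) else v (n div 2)) \<in> E"
      by (simp add: E_def)
    then show "x \<in> fst ` E" by force
  next
    fix x assume "x \<in> fst ` E"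
    then obtain w where "((x, \<lambda>n. w (2 * n)), \<lambda>n. w (Suc (2 * n))) \<in> C"
      by (auto simp: E_def)
    then show "x \<in> fst ` Q"
      unfolding C(2) by force
  qed
  ultimately show ?thesis
    unfolding analytic_def by blast
qed

section \<open>Analytic sets and category in the Baire space\<close>

text \<open>A finite sequence is represented by its length and any infinite extension, so every
  member of a cylinder can serve as its centre.\<close>

definition cyl :: "nat \<Rightarrow> (nat \<Rightarrow> nat) \<Rightarrow> (nat \<Rightarrow> nat) set" where
  "cyl k x = {y. \<forall>i<k. y i = x i}"

lemma cyl_refl [simp]: "x \<in> cyl k x"
  by (simp add: cyl_def)

lemma cyl_eq: "y \<in> cyl k x \<Longrightarrow> cyl k y = cyl k x"
  by (auto simp: cyl_def)

lemma cyl_antimono: "k \<le> l \<Longrightarrow> cyl l x \<subseteq> cyl k x"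
  by (auto simp: cyl_def)

definition cyls :: "(nat \<Rightarrow> nat) set set" where
  "cyls = {cyl k x | k x. True}"

lemma cyl_in_cyls [simp]: "cyl k x \<in> cyls"
  by (auto simp: cyls_def)

lemma countable_cyls: "countable cyls"
proof -
  have "cyl k x = {y. map y [0..<k] = map x [0..<k]}" for k x
    by (auto simp: cyl_def)
  then have "cyls \<subseteq> range (\<lambda>l. {y. map y [0..<length l] = l})"
    unfolding cyls_def by (auto intro!: image_eqI[of _ _ "map _ [0..<_]"])
  then show ?thesis
    by (rule countable_subset) simp
qed

text \<open>There are only countably many cylinders, so an injective index is available. The lower
  bound on the length lets a decreasing sequence settle every coordinate.\<close>

interpretation cyl: category_base cyls "to_nat_on cyls" "\<lambda>n. {cyl k x | k x. n \<le> k}"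
proof
  fix V W assume "V \<in> cyls" "W \<in> cyls" "V \<inter> W \<noteq> {}"
  then obtain k x l y z where "V = cyl k x" "W = cyl l y" "z \<in> V" "z \<in> W"
    unfolding cyls_def by blast
  then have "V = cyl k z" "W = cyl l z"
    using cyl_eq by auto
  then have "V \<inter> W = cyl (max k l) z"
    by (auto simp: cyl_def less_max_iff_disj)
  then show "V \<inter> W \<in> cyls" by simp
next
  fix V W assume "V \<in> cyls" "W \<in> cyls" "to_nat_on cyls V = to_nat_on cyls W"
  then have "V = W" using countable_cyls by simp
  then show "V \<inter> W \<noteq> {}"
    using \<open>V \<in> cyls\<close> by (auto simp: cyls_def intro: cyl_refl)
next
  fix V n assume "V \<in> cyls"
  then obtain k x where "V = cyl k x" by (auto simp: cyls_def)
  then show "\<exists>W\<in>cyls \<inter> {cyl k x | k x. n \<le> k}. W \<subseteq> V"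
    using cyl_antimono[of k "max n k" x] by (intro bexI[of _ "cyl (max n k) x"]) force+
next
  fix U :: "nat \<Rightarrow> (nat \<Rightarrow> nat) set"
  assume "\<And>n. U n \<in> cyls \<inter> {cyl k x | k x. n \<le> k}" and dec: "decseq U"
  then have "\<forall>n. \<exists>k x. U n = cyl k x \<and> n \<le> k" by blast
  then obtain k x where U: "\<And>n. U n = cyl (k n) (x n)" "\<And>n. n \<le> k n"
    by metis
  \<comment> \<open>Coordinate \<open>i\<close> is settled by stage \<open>Suc i\<close>, whose
    cylinder has length greater than \<open>i\<close>.\<close>
  have "(\<lambda>i. x (Suc i) i) \<in> U n" for n
  proof -
    have "x (Suc i) i = x n i" if "i < k n" for i
    proof -
      have "x (max n (Suc i)) \<in> U n \<inter> U (Suc i)"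
        using dec U(1) by (metis IntI cyl_refl decseqD max.cobounded1 max.cobounded2 subsetD)
      then show ?thesis
        using that U(2)[of "Suc i"] by (auto simp: U(1) cyl_def)
    qed
    then show ?thesis by (simp add: U(1) cyl_def)
  qed
  then show "(\<Inter>n. U n) \<noteq> {}" by blast
qed

lemma tendsto_if_in_cyl:
  assumes "\<And>n. a n \<in> cyl n x"
  shows "a \<longlonglongrightarrow> x"
proof -
  have "(\<lambda>n. a n i) \<longlonglongrightarrow> x i" for i
  proof (rule tendsto_eventually)
    show "\<forall>\<^sub>F n in sequentially. a n i = x i"
      using eventually_gt_at_top[of i] by eventually_elim (use assms in \<open>auto simp: cyl_def\<close>)
  qed
  then have "limitin (product_topology (\<lambda>_. euclidean) UNIV) a x sequentially"
    by (simp add: limitin_componentwise)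
  then show ?thesis
    by (simp add: euclidean_product_topology)
qed

text \<open>Keeping the first \<open>p\<close> coordinates maps each cylinder of length
  \<open>p\<close> into itself. With \<open>swap_parity\<close> for \<sigma>, a point and its image
  have opposite parities at every coordinate from \<open>p\<close> on.\<close>

definition tail_map :: "(nat \<Rightarrow> nat) \<Rightarrow> nat \<Rightarrow> (nat \<Rightarrow> nat) \<Rightarrow> nat \<Rightarrow> nat" where
  "tail_map \<sigma> p x i = (if i < p then x i else \<sigma> (x i))"

lemma tail_map_cyl: "y \<in> cyl k x \<Longrightarrow> tail_map \<sigma> p y \<in> cyl k (tail_map \<sigma> p x)"
  by (auto simp: cyl_def tail_map_def)

text \<open>Both points are built by one fusion, which at each stage keeps the sections of a closed set
  projecting onto \<open>W\<close> full along both branches; so the Baire property of analytic sets is not needed.\<close>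

theorem analytic_nonmeager_tail_map:
  fixes W :: "(nat \<Rightarrow> nat) set"
  assumes an: "analytic W" and nonmeager: "\<not> cyl.meager W"
    and inv: "\<And>n. \<sigma> (\<sigma> n) = n"
  shows "\<exists>p. \<exists>x\<in>W. tail_map \<sigma> p x \<in> W"
proof -
  obtain C :: "((nat \<Rightarrow> nat) \<times> (nat \<Rightarrow> nat)) set" where C: "closed C" "W = fst ` C"
    using an unfolding analytic_def by blast
  \<comment> \<open>The points of \<open>W\<close> having a witness that agrees with
    \<open>w\<close> below \<open>j\<close>; fixing one more witness value splits this set into
    countably many pieces.\<close>
  define E where "E j w = {x. \<exists>v\<in>cyl j w. (x, v) \<in> C}" for j w
  have E_Suc: "E j w = (\<Union>n. E (Suc j) (w(j := n)))" for j w
  proof (intro equalityI subsetI)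
    fix x assume "x \<in> E j w"
    then obtain v where "v \<in> cyl j w" "(x, v) \<in> C" by (auto simp: E_def)
    moreover from this(1) have "v \<in> cyl (Suc j) (w(j := v j))"
      by (auto simp: cyl_def less_Suc_eq)
    ultimately show "x \<in> (\<Union>n. E (Suc j) (w(j := n)))" unfolding E_def by blast
  next
    fix x assume "x \<in> (\<Union>n. E (Suc j) (w(j := n)))"
    then obtain n v where "v \<in> cyl (Suc j) (w(j := n))" "(x, v) \<in> C" by (auto simp: E_def)
    moreover from this(1) have "v \<in> cyl j w"
      by (auto simp: cyl_def)
    ultimately show "x \<in> E j w" unfolding E_def by blast
  qed
  have E_full_step: "\<exists>l y w'. cyl l y \<subseteq> cyl k x \<and> w' \<in> cyl j w \<and> cyl.full (E (Suc j) w') (cyl l y)"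
    if full: "cyl.full (E j w) (cyl k x)" for j w k x
  proof -
    obtain n V where "V \<subseteq> cyl k x" "cyl.full (E (Suc j) (w(j := n))) V"
      using full E_Suc cyl.full_UN by metis
    moreover from this(2) have "V \<in> cyls"
      by (simp add: cyl.full_def)
    then obtain l y where "V = cyl l y"
      unfolding cyls_def by blast
    moreover have "w(j := n) \<in> cyl j w" by (simp add: cyl_def)
    ultimately show ?thesis by blast
  qed
  have "W = E 0 undefined"
    by (auto simp: C(2) E_def cyl_def intro: rev_image_eqI)
  then obtain V0 where V0: "cyl.full (E 0 undefined) V0"
    using nonmeager cyl.ex_full by blast
  then have "V0 \<in> cyls"
    by (simp add: cyl.full_def)
  then obtain p x0 where x0: "cyl.full (E 0 undefined) (cyl p x0)"
    using V0 unfolding cyls_def by blast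
  \<comment> \<open>Here \<open>p\<close> is the length of a cylinder on which \<open>W\<close> is
    full. As \<open>h\<close> preserves this cylinder, both branches can start in it.\<close>
  define h where "h = tail_map \<sigma> p"
  have hh [simp]: "h (h x) = x" for x
    by (auto simp: h_def tail_map_def inv)
  have h_cyl: "h y \<in> cyl k (h x)" if "y \<in> cyl k x" for x y k
    using that tail_map_cyl by (simp add: h_def)
  have h_x0: "h x0 \<in> cyl p x0"
    by (simp add: h_def tail_map_def cyl_def)
  \<comment> \<open>A state consists of a length \<open>k\<close>, a centre \<open>x\<close>, and
    partial witnesses \<open>w\<close> for the limit point and \<open>w'\<close> for its image under
    \<open>h\<close>.\<close>
  define good where "good j = (\<lambda>(k, x, w, w'). j \<le> k \<and>
      cyl.full (E j w) (cyl k x) \<and> cyl.full (E j w') (cyl k (h x)))" for j :: nat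
  define ext where "ext j = (\<lambda>(k, x, w, w') (l :: nat, y, v, v').
      k \<le> l \<and> y \<in> cyl k x \<and> v \<in> cyl j w \<and> v' \<in> cyl j w')" for j :: nat
  have "\<exists>s. \<forall>j. good j (s j) \<and> ext j (s j) (s (Suc j))"
  proof (rule dependent_nat_choice)
    show "\<exists>s. good 0 s"
      using x0 cyl_eq[OF h_x0] by (intro exI[of _ "(p, x0, undefined, undefined)"]) (simp add: good_def)
  next
    fix s j assume "good j s"
    then obtain k x w w' where s: "s = (k, x, w, w')" and "j \<le> k"
      and full: "cyl.full (E j w) (cyl k x)" "cyl.full (E j w') (cyl k (h x))"
      by (auto simp: good_def)
    \<comment> \<open>Extend the first branch, carry the result over by \<open>h\<close>, extend the
      second branch there, and come back by \<open>h\<close>, which is an involution.\<close>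
    obtain k1 x1 v where 1: "cyl k1 x1 \<subseteq> cyl k x" "v \<in> cyl j w" "cyl.full (E (Suc j) v) (cyl k1 x1)"
      using E_full_step full(1) by blast
    \<comment> \<open>The \<open>Suc\<close> guarantees that the final length \<open>m\<close> is at
      least \<open>Suc j\<close>.\<close>
    define l where "l = Suc (k + k1)"
    have "x1 \<in> cyl k x" using 1(1) cyl_refl by blast
    then have "cyl l (h x1) \<subseteq> cyl k (h x)"
      using h_cyl[of x1 k x] cyl_eq cyl_antimono[of k l] by (simp add: l_def) metis
    then have "cyl.full (E j w') (cyl l (h x1))"
      using full(2) cyl.full_mono by simp
    then obtain k2 y v' where
      2: "cyl k2 y \<subseteq> cyl l (h x1)" "v' \<in> cyl j w'" "cyl.full (E (Suc j) v') (cyl k2 y)"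
      using E_full_step by blast
    define m where "m = l + k2"
    have "y \<in> cyl l (h x1)" using 2(1) cyl_refl by blast
    then have hy: "h y \<in> cyl l x1"
      using h_cyl[of y l "h x1"] by simp
    have "cyl m (h y) \<subseteq> cyl l (h y)"
      by (intro cyl_antimono) (simp add: m_def)
    also have "\<dots> = cyl l x1"
      by (rule cyl_eq[OF hy])
    also have "\<dots> \<subseteq> cyl k1 x1"
      by (intro cyl_antimono) (simp add: l_def)
    finally have "cyl.full (E (Suc j) v) (cyl m (h y))"
      using 1(3) cyl.full_mono by simp
    moreover have "cyl.full (E (Suc j) v') (cyl m y)"
      using 2(3) cyl_antimono[of k2 m y] cyl.full_mono by (simp add: m_def)
    moreover have "h y \<in> cyl k x"
      using hy \<open>x1 \<in> cyl k x\<close> by (auto simp: cyl_def l_def)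
    ultimately show "\<exists>s'. good (Suc j) s' \<and> ext j s s'"
      using \<open>j \<le> k\<close> 1(2) 2(2)
      by (intro exI[of _ "(m, h y, v, v')"]) (simp add: good_def ext_def s m_def l_def)
  qed
  then obtain s where s: "\<And>j. good j (s j)" "\<And>j. ext j (s j) (s (Suc j))"
    by blast
  define k x w w' where "k j = fst (s j)" and "x j = fst (snd (s j))"
    and "w j = fst (snd (snd (s j)))" and "w' j = snd (snd (snd (s j)))" for j
  have s_eq: "s j = (k j, x j, w j, w' j)" for j
    by (simp add: k_def x_def w_def w'_def)
  have j_le: "j \<le> k j" and full: "cyl.full (E j (w j)) (cyl (k j) (x j))"
    and full': "cyl.full (E j (w' j)) (cyl (k j) (h (x j)))" for j
    using s(1)[of j] by (simp_all add: good_def s_eq)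
  have "x (Suc j) \<in> cyl (k j) (x j)" and w_Suc: "w (Suc j) \<in> cyl j (w j)"
    and w'_Suc: "w' (Suc j) \<in> cyl j (w' j)" for j
    using s(2)[of j] by (simp_all add: ext_def s_eq)
  then have x_Suc: "x (Suc j) \<in> cyl j (x j)" for j
    using j_le cyl_antimono by blast
  have limit: "\<exists>b. \<forall>j. b \<in> cyl j (a j)" if a: "\<And>j. a (Suc j) \<in> cyl j (a j)" for a :: "nat \<Rightarrow> nat \<Rightarrow> nat"
  proof -
    have "a (j + d) \<in> cyl j (a j)" for j d
    proof (induction d)
      case (Suc d)
      then show ?case using a[of "j + d"] by (auto simp: cyl_def)
    qed simp
    then have mono: "a n \<in> cyl j (a j)" if "j \<le> n" for j n
      using le_Suc_ex[OF that] by blast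
    have "a (Suc i) i = a j i" if "i < j" for i j
      using mono[of "Suc i" j] that by (simp add: cyl_def)
    then have "(\<lambda>i. a (Suc i) i) \<in> cyl j (a j)" for j
      unfolding cyl_def by blast
    then show ?thesis by blast
  qed
  obtain X where X: "\<And>j. X \<in> cyl j (x j)" using limit[OF x_Suc] by blast
  obtain Y where Y: "\<And>j. Y \<in> cyl j (w j)" using limit[OF w_Suc] by blast
  obtain Y' where Y': "\<And>j. Y' \<in> cyl j (w' j)" using limit[OF w'_Suc] by blast
  \<comment> \<open>Fullness enters as nonemptiness: at each stage \<open>C\<close> has a point
    agreeing with \<open>(b, z)\<close> below \<open>j\<close>. These points converge to
    \<open>(b, z)\<close>, and \<open>C\<close> is closed.\<close>
  have in_W: "b \<in> W" if b: "\<And>j. b \<in> cyl j (c j)" and v: "\<And>j. z \<in> cyl j (v j)"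
    and fu: "\<And>j. cyl.full (E j (v j)) (cyl (k j) (c j))"
    for b z and c v :: "nat \<Rightarrow> nat \<Rightarrow> nat"
  proof -
    have "\<exists>q\<in>C. fst q \<in> cyl j b \<and> snd q \<in> cyl j z" for j
    proof -
      have "E j (v j) \<inter> cyl (k j) (c j) \<noteq> {}"
        using fu by (rule cyl.full_Int_nonempty)
      then obtain q where "q \<in> C" "fst q \<in> cyl (k j) (c j)" "snd q \<in> cyl j (v j)"
        unfolding E_def by fastforce
      then show ?thesis
        using cyl_antimono[OF j_le[of j], of "c j"] cyl_eq[OF b, of j] cyl_eq[OF v, of j] by blast
    qed
    then obtain q where q: "\<And>j. q j \<in> C" "\<And>j. fst (q j) \<in> cyl j b" "\<And>j. snd (q j) \<in> cyl j z"
      by metis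
    have "(\<lambda>j. (fst (q j), snd (q j))) \<longlonglongrightarrow> (b, z)"
      by (intro tendsto_Pair tendsto_if_in_cyl q)
    then have "(b, z) \<in> C"
      using closed_sequentially[OF C(1), of q "(b, z)"] q(1) by simp
    then show ?thesis unfolding C(2) by (rule rev_image_eqI) simp
  qed
  have "X \<in> W" by (rule in_W[OF X Y full])
  moreover have "h X \<in> W" by (rule in_W[OF h_cyl[OF X] Y' full'])
  ultimately show ?thesis unfolding h_def by blast
qed

section \<open>The Mathias--Prikry category base of a filter\<close>

definition ebox :: "nat set \<Rightarrow> nat set \<Rightarrow> nat set set" where
  "ebox s K = {A. infinite A \<and> s \<subseteq> A \<and> A \<subseteq> K}"

lemma ebox_Int: "ebox s K \<inter> ebox t L = ebox (s \<union> t) (K \<inter> L)"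
  by (auto simp: ebox_def)

lemma ebox_mono: "t \<subseteq> s \<Longrightarrow> K \<subseteq> L \<Longrightarrow> ebox s K \<subseteq> ebox t L"
  by (auto simp: ebox_def)

locale infinite_filter_base =
  fixes F :: "nat set set"
  assumes F_Int: "K \<in> F \<Longrightarrow> L \<in> F \<Longrightarrow> K \<inter> L \<in> F"
    and F_infinite: "K \<in> F \<Longrightarrow> infinite K"
begin

definition cond :: "nat set \<Rightarrow> nat set \<Rightarrow> bool" where
  "cond s K \<longleftrightarrow> finite s \<and> s \<subseteq> K \<and> K \<in> F"

definition boxes :: "nat set set set" where
  "boxes = {ebox s K | s K. cond s K}"

text \<open>Choosing a presentation avoids proving that a box determines its stem; equal codes still
  give presentations with a common stem.\<close>

definition stem_code :: "nat set set \<Rightarrow> nat" where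
  "stem_code V = to_nat_on (Collect finite) (SOME s. \<exists>K. cond s K \<and> V = ebox s K)"

text \<open>Growing stems make the union of the stems of a decreasing sequence infinite, hence a
  common point of its boxes.\<close>

definition large_stem :: "nat \<Rightarrow> nat set set set" where
  "large_stem n = {ebox s K | s K. cond s K \<and> n \<le> card s}"

lemma ebox_in_boxes: "cond s K \<Longrightarrow> ebox s K \<in> boxes"
  unfolding boxes_def by blast

lemma boxesE:
  assumes "V \<in> boxes"
  obtains s K where "cond s K" "V = ebox s K"
  using assms unfolding boxes_def by blast

lemma top_in_ebox: "cond s K \<Longrightarrow> K \<in> ebox s K"
  by (simp add: cond_def ebox_def F_infinite)

lemma cond_Un_Int: "cond s K \<Longrightarrow> cond t L \<Longrightarrow> s \<subseteq> L \<Longrightarrow> t \<subseteq> K \<Longrightarrow> cond (s \<union> t) (K \<inter> L)"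
  by (auto simp: cond_def F_Int)

sublocale category_base boxes stem_code large_stem
proof
  fix V W assume "V \<in> boxes" "W \<in> boxes" "V \<inter> W \<noteq> {}"
  then obtain s K t L where c: "cond s K" "cond t L" and VW: "V = ebox s K" "W = ebox t L"
    by (auto elim!: boxesE)
  with \<open>V \<inter> W \<noteq> {}\<close> have "s \<subseteq> L" "t \<subseteq> K"
    by (auto simp: ebox_def)
  then show "V \<inter> W \<in> boxes"
    unfolding VW ebox_Int using c by (intro ebox_in_boxes cond_Un_Int)
next
  fix V W assume V: "V \<in> boxes" and W: "W \<in> boxes" and eq: "stem_code V = stem_code W"
  define stem where "stem V = (SOME s. \<exists>K. cond s K \<and> V = ebox s K)" for V
  have stem: "\<exists>K. cond (stem V) K \<and> V = ebox (stem V) K" if "V \<in> boxes" for V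
    unfolding stem_def by (rule someI_ex) (use that in \<open>auto elim!: boxesE\<close>)
  then have "finite (stem V)" "finite (stem W)"
    using V W by (auto simp: cond_def)
  then have "stem V = stem W"
    using eq unfolding stem_code_def stem_def[symmetric]
    by (simp add: countable_Collect_finite)
  then obtain s K L where c: "cond s K" "cond s L" and VW: "V = ebox s K" "W = ebox s L"
    using stem V W by metis
  have "cond s (K \<inter> L)"
    using cond_Un_Int[OF c] c by (simp add: cond_def)
  then show "V \<inter> W \<noteq> {}"
    unfolding VW ebox_Int using top_in_ebox by auto
next
  fix V n assume "V \<in> boxes"
  then obtain s K where c: "cond s K" and V: "V = ebox s K"
    by (rule boxesE)
  have "infinite (K - s)"
    using c F_infinite by (auto simp: cond_def)
  then obtain t where t: "finite t" "card t = n" "t \<subseteq> K - s"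
    using infinite_arbitrarily_large by blast
  then have c': "cond (s \<union> t) K"
    using c by (auto simp: cond_def)
  moreover have "n \<le> card (s \<union> t)"
    using t c by (metis Un_upper2 card_mono cond_def c')
  ultimately show "\<exists>W\<in>boxes \<inter> large_stem n. W \<subseteq> V"
    using ebox_mono[of s "s \<union> t" K K] unfolding V boxes_def large_stem_def by blast
next
  fix U :: "nat \<Rightarrow> nat set set"
  assume "\<And>n. U n \<in> boxes \<inter> large_stem n" and dec: "decseq U"
  then have "\<forall>n. \<exists>s K. cond s K \<and> n \<le> card s \<and> U n = ebox s K"
    unfolding large_stem_def by blast
  then obtain s K where c: "\<And>n. cond (s n) (K n)" and card: "\<And>n. n \<le> card (s n)"
    and U: "\<And>n. U n = ebox (s n) (K n)"
    by metis
  \<comment> \<open>The later of the two boxes contains its own upper bound, which therefore lies in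
    both and is squeezed between \<open>s m\<close> and \<open>K n\<close>.\<close>
  have "s m \<subseteq> K n" for m n
  proof -
    have "K (max m n) \<in> U m \<inter> U n"
      using dec top_in_ebox[OF c] U by (metis IntI decseqD max.cobounded1 max.cobounded2 subsetD)
    then show ?thesis by (auto simp: U ebox_def)
  qed
  moreover have "infinite (\<Union>m. s m)"
  proof
    assume fin: "finite (\<Union>m. s m)"
    then have "card (s n) \<le> card (\<Union>m. s m)" for n
      by (intro card_mono) auto
    then show False
      using card[of "Suc (card (\<Union>m. s m))"] by (meson Suc_n_not_le_n order_trans)
  qed
  ultimately have "(\<Union>m. s m) \<in> (\<Inter>n. U n)"
    by (auto simp: U ebox_def)
  then show "(\<Inter>n. U n) \<noteq> {}" by blast
qed

lemma decided_mem: "decided {A \<in> infsets. n \<in> A}"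
  unfolding decided_def
proof
  fix V assume V: "V \<in> boxes"
  then obtain s K where c: "cond s K" and Veq: "V = ebox s K"
    by (rule boxesE)
  let ?P = "{A \<in> infsets. n \<in> A}"
  show "\<exists>W\<in>boxes. W \<subseteq> V \<and> (meager (W \<inter> ?P) \<or> meager (W - ?P))"
  proof (cases "n \<in> K")
    case True
    then have "cond (insert n s) K" using c by (simp add: cond_def)
    moreover have "ebox (insert n s) K - ?P = {}"
      by (auto simp: ebox_def infsets_def)
    then have "meager (ebox (insert n s) K - ?P)"
      by (simp only: meager_empty)
    ultimately show ?thesis
      using ebox_in_boxes ebox_mono[of s "insert n s" K K] unfolding Veq by blast
  next
    case False
    then have "V \<inter> ?P = {}" by (auto simp: Veq ebox_def)
    then show ?thesis using V meager_empty by (intro bexI[of _ V]) simp_all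
  qed
qed

text \<open>This makes the relation ``\<open>(s, G)\<close> forces \<open>A \<notin> P\<close>'' Borel in \<open>G\<close>: for each stem \<open>t\<close> a single
  condition \<open>(t, L)\<close> forcing \<open>A \<in> P\<close>, if there is one, represents all others,
  because conditions with the same stem are compatible.\<close>

lemma meager_ebox_code:
  assumes dec: "decided P"
  shows "\<exists>T. countable T \<and>
    (\<forall>s G. cond s G \<longrightarrow> (meager (P \<inter> ebox s G) \<longleftrightarrow> (\<forall>(t, L)\<in>T. \<not> (s \<subseteq> L \<and> t \<subseteq> G))))"
proof -
  define ok where "ok t L \<longleftrightarrow> cond t L \<and> meager (ebox t L - P)" for t L
  define J where "J = {t. \<exists>L. ok t L}"
  define L where "L t = (SOME L. ok t L)" for t
  have L: "ok t (L t)" if "t \<in> J" for t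
    using that someI_ex unfolding J_def L_def by force
  have fin: "J \<subseteq> Collect finite"
    by (auto simp: J_def ok_def cond_def)
  have "meager (P \<inter> ebox s G) \<longleftrightarrow> (\<forall>t\<in>J. \<not> (s \<subseteq> L t \<and> t \<subseteq> G))" if c: "cond s G" for s G
  proof
    assume m: "meager (P \<inter> ebox s G)"
    show "\<forall>t\<in>J. \<not> (s \<subseteq> L t \<and> t \<subseteq> G)"
    proof (intro ballI notI)
      \<comment> \<open>Compatibility would give a box in which both \<open>P\<close> and its
        complement are meager.\<close>
      fix t assume t: "t \<in> J" and comp: "s \<subseteq> L t \<and> t \<subseteq> G"
      then have "ebox (s \<union> t) (G \<inter> L t) \<in> boxes"
        using L[OF t] c by (intro ebox_in_boxes cond_Un_Int) (auto simp: ok_def)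
      moreover have "meager ((P \<inter> ebox s G) \<union> (ebox t (L t) - P))"
        using m L[OF t] by (intro meager_Un) (auto simp: ok_def)
      then have "meager (ebox (s \<union> t) (G \<inter> L t))"
        by (rule meager_subset) (auto simp: ebox_def)
      ultimately show False using baire by blast
    qed
  next
    assume incomp: "\<forall>t\<in>J. \<not> (s \<subseteq> L t \<and> t \<subseteq> G)"
    show "meager (P \<inter> ebox s G)"
    proof (rule ccontr)
      assume "\<not> meager (P \<inter> ebox s G)"
      then obtain W where "W \<in> boxes" "W \<subseteq> ebox s G" "meager (W - P)"
        using ex_comeager_subset[OF dec ebox_in_boxes[OF c]] by blast
      \<comment> \<open>The representative \<open>L t\<close> shares its stem with \<open>H\<close>,
        so \<open>H \<inter> L t\<close> lies in the box of \<open>(s, G)\<close>. Hence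
        \<open>(t, L t)\<close> is compatible with \<open>(s, G)\<close>.\<close>
      then obtain t H where H: "ok t H" "ebox t H \<subseteq> ebox s G"
        by (metis boxesE ok_def)
      then have t: "t \<in> J" by (auto simp: J_def)
      have tH: "cond t H" using H(1) by (simp add: ok_def)
      have "H \<in> ebox s G" using top_in_ebox[OF tH] H(2) by blast
      then have "t \<subseteq> G"
        using tH by (auto simp: ebox_def cond_def)
      have tL: "cond t (L t)" using L[OF t] by (simp add: ok_def)
      have "cond t (H \<inter> L t)"
        using cond_Un_Int[OF tH tL] tH tL by (simp add: cond_def)
      then have "H \<inter> L t \<in> ebox s G"
        using top_in_ebox H(2) ebox_mono[of t t "H \<inter> L t" H] by blast
      then have "s \<subseteq> L t" by (auto simp: ebox_def)
      with \<open>t \<subseteq> G\<close> t incomp show False by blast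
    qed
  qed
  then show ?thesis
    using fin countable_subset[OF fin countable_Collect_finite]
    by (intro exI[of _ "(\<lambda>t. (t, L t)) ` J"]) auto
qed

end

section \<open>Borel structure of \<open>infsets\<close>\<close>

lemma openin_infsets_mem: "openin infsets_topology {A \<in> infsets. n \<in> A}"
proof -
  let ?T = "product_topology (\<lambda>_::nat. discrete_topology (UNIV :: bool set)) UNIV"
  have "openin ?T {f \<in> topspace ?T. f n \<in> {True}}"
    by (rule openin_continuous_map_preimage[of ?T "discrete_topology UNIV"])
       (rule continuous_map_product_coordinates, simp_all)
  then show ?thesis
    unfolding infsets_topology_def openin_pullback_topology
    by (intro exI[of _ "{f. f n}"]) auto
qed

text \<open>A basic open set restricts finitely many coordinates, hence only some below a bound
  \<open>k\<close>. So every open set is a union of sets fixing the trace on \<open>{..<k}\<close>,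
  and there are countably many such traces.\<close>

lemma sets_infsets_borel_eq:
  "sets infsets_borel = sigma_sets infsets (range (\<lambda>n. {A \<in> infsets. n \<in> A}))" (is "_ = ?\<Sigma>")
proof
  interpret S: sigma_algebra infsets ?\<Sigma>
    by (rule sigma_algebra_sigma_sets) auto
  have mem: "{A \<in> infsets. n \<in> A} \<in> ?\<Sigma>" for n
    by (intro sigma_sets.Basic) auto
  have cylinder: "{A \<in> infsets. A \<inter> {..<k} = a} \<in> ?\<Sigma>" for k and a :: "nat set"
  proof (cases "a \<subseteq> {..<k}")
    case True
    have "{A \<in> infsets. i \<in> A \<longleftrightarrow> i \<in> a} \<in> ?\<Sigma>" for i
    proof (cases "i \<in> a")
      case False
      have "infsets - {A \<in> infsets. i \<in> A} \<in> ?\<Sigma>"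
        using mem by blast
      also have "infsets - {A \<in> infsets. i \<in> A} = {A \<in> infsets. i \<in> A \<longleftrightarrow> i \<in> a}"
        using False by auto
      finally show ?thesis .
    qed (use mem in simp)
    then have "{A \<in> infsets. \<forall>i\<in>{..<k}. i \<in> A \<longleftrightarrow> i \<in> a} \<in> ?\<Sigma>"
      by (intro S.sets_Collect_finite_All) auto
    also have "{A \<in> infsets. \<forall>i\<in>{..<k}. i \<in> A \<longleftrightarrow> i \<in> a} = {A \<in> infsets. A \<inter> {..<k} = a}"
      using True by auto
    finally show ?thesis .
  next
    case False
    then have "{A \<in> infsets. A \<inter> {..<k} = a} = {}" by auto
    then show ?thesis by (simp only: S.empty_sets)
  qed
  have "U \<in> ?\<Sigma>" if U: "openin infsets_topology U" for U
  proof -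
    define cylinder_set where "cylinder_set = (\<lambda>(k, a). {A \<in> infsets. A \<inter> {..<k} = a})"
    define I where "I = {(k, a). finite a \<and> cylinder_set (k, a) \<subseteq> U}"
    obtain O' where O': "openin (product_topology (\<lambda>_::nat. discrete_topology (UNIV :: bool set)) UNIV) O'"
      "U = (\<lambda>A n. n \<in> A) -` O' \<inter> infsets"
      using U unfolding infsets_topology_def openin_pullback_topology by blast
    have nbhd: "\<exists>V. finite {i. V i \<noteq> UNIV} \<and> f \<in> Pi\<^sub>E UNIV V \<and> Pi\<^sub>E UNIV V \<subseteq> O'" if "f \<in> O'" for f
    proof -
      obtain V where "finite {i \<in> UNIV. V i \<noteq> topspace (discrete_topology (UNIV :: bool set))}"
        "f \<in> Pi\<^sub>E UNIV V" "Pi\<^sub>E UNIV V \<subseteq> O'"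
        using O'(1) \<open>f \<in> O'\<close> unfolding openin_product_topology_alt by blast
      then show ?thesis by (intro exI[of _ V]) simp
    qed
    have "U = (\<Union>i\<in>I. cylinder_set i)"
    proof (intro equalityI subsetI)
      fix A assume A: "A \<in> U"
      then have "(\<lambda>n. n \<in> A) \<in> O'" by (simp add: O'(2))
      then obtain V where V: "finite {i. V i \<noteq> UNIV}" "(\<lambda>n. n \<in> A) \<in> Pi\<^sub>E UNIV V" "Pi\<^sub>E UNIV V \<subseteq> O'"
        using nbhd by blast
      obtain k where k: "{i. V i \<noteq> UNIV} \<subseteq> {..<k}"
        using V(1) finite_nat_iff_bounded by blast
      have "cylinder_set (k, A \<inter> {..<k}) \<subseteq> U"
      proof
        fix B assume B: "B \<in> cylinder_set (k, A \<inter> {..<k})"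
        have "(i \<in> B) \<in> V i" for i
        proof (cases "i < k")
          case True
          then have "i \<in> B \<longleftrightarrow> i \<in> A" using B by (auto simp: cylinder_set_def)
          then show ?thesis using V(2) by (auto simp: PiE_iff)
        next
          case False
          then have "V i = UNIV" using k by auto
          then show ?thesis by simp
        qed
        then have "(\<lambda>n. n \<in> B) \<in> O'" using V(3) by (auto simp: PiE_iff)
        then show "B \<in> U" using B by (simp add: O'(2) cylinder_set_def)
      qed
      moreover have "A \<in> infsets" using A O'(2) by simp
      ultimately show "A \<in> (\<Union>i\<in>I. cylinder_set i)"
        by (auto simp: I_def cylinder_set_def intro!: bexI[of _ "(k, A \<inter> {..<k})"])
    qed (auto simp: I_def)
    moreover have "countable I"
      by (rule countable_subset[of _ "UNIV \<times> Collect finite"])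
         (auto simp: I_def intro!: countable_SIGMA countable_Collect_finite)
    then have "(\<Union>i\<in>I. cylinder_set i) \<in> ?\<Sigma>"
      by (intro S.countable_UN') (auto simp: cylinder_set_def cylinder)
    ultimately show ?thesis by simp
  qed
  then show "sets infsets_borel \<subseteq> ?\<Sigma>"
    unfolding sets_infsets_borel by (intro S.sigma_sets_subset) auto
  show "?\<Sigma> \<subseteq> sets infsets_borel"
    unfolding sets_infsets_borel by (intro sigma_sets_mono) (auto intro: openin_infsets_mem)
qed

lemma infsets_mem_borel: "{A \<in> infsets. n \<in> A} \<in> sets infsets_borel"
  unfolding sets_infsets_borel_eq by (intro sigma_sets.Basic) auto

lemma (in infinite_filter_base) decided_borel:
  assumes "P \<in> sets infsets_borel"
  shows "decided P"
proof (rule decided_sigma_sets)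
  show "P \<in> sigma_sets infsets (range (\<lambda>n. {A \<in> infsets. n \<in> A}))"
    using assms by (simp only: sets_infsets_borel_eq)
  show "\<Union>boxes \<subseteq> infsets"
    by (auto simp: boxes_def ebox_def infsets_def)
qed (use decided_mem in blast)

lemma measurable_into_infsets_borel:
  assumes "\<And>x. x \<in> space M \<Longrightarrow> infinite (f x)" "\<And>n. {x \<in> space M. n \<in> f x} \<in> sets M"
  shows "f \<in> M \<rightarrow>\<^sub>M infsets_borel"
proof (rule measurable_sigma_sets[OF sets_infsets_borel_eq])
  show "f \<in> space M \<rightarrow> infsets"
    using assms(1) by (simp add: infsets_def)
next
  fix Y assume "Y \<in> range (\<lambda>n. {A \<in> infsets. n \<in> A})"
  then obtain n where "Y = {A \<in> infsets. n \<in> A}" by blast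
  then have "f -` Y \<inter> space M = {x \<in> space M. n \<in> f x}"
    using assms(1) by (auto simp: infsets_def)
  then show "f -` Y \<inter> space M \<in> sets M"
    using assms(2) by simp
qed auto

lemma sets_mem_infsets_borel:
  assumes f: "f \<in> M \<rightarrow>\<^sub>M infsets_borel"
  shows "{x \<in> space M. n \<in> f x} \<in> sets M"
proof -
  have "f x \<in> infsets" if "x \<in> space M" for x
    using measurable_space[OF f that] by (simp add: space_infsets_borel)
  then have "{x \<in> space M. n \<in> f x} = f -` {A \<in> infsets. n \<in> A} \<inter> space M"
    by auto
  then show ?thesis
    using measurable_sets[OF f infsets_mem_borel] by simp
qed

section \<open>Coding by points of the Baire space, and the contradiction\<close>

definition swap_parity :: "nat \<Rightarrow> nat" where
  "swap_parity n = (if even n then Suc n else n - 1)"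

lemma swap_parity_swap_parity: "swap_parity (swap_parity n) = n"
  by (auto simp: swap_parity_def)

text \<open>A point \<open>x\<close> codes the set of all \<open>n\<close> with \<open>x n\<close>
  even; swapping the parity of its values complements that set.\<close>

lemma even_swap_parity: "even (swap_parity n) \<longleftrightarrow> odd n"
  by (auto simp: swap_parity_def)

text \<open>Codes of finite sets are redirected to \<open>UNIV\<close>, so that every \<open>w\<close> codes a sequence of infinite sets.\<close>

definition coded :: "nat \<Rightarrow> (nat \<Rightarrow> nat) \<Rightarrow> nat set" where
  "coded j w = (let A = {n. odd (w (prod_encode (j, n)))} in if infinite A then A else UNIV)"

lemma coded_in_infsets: "coded j w \<in> infsets"
  by (simp add: coded_def infsets_def Let_def)

lemma coded_surj:
  assumes "\<And>j. B j \<in> infsets"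
  shows "\<exists>w. \<forall>j. coded j w = B j"
proof -
  define w :: "nat \<Rightarrow> nat" where
    "w i = (case prod_decode i of (j, n) \<Rightarrow> of_bool (n \<in> B j))" for i
  have "{n. odd (w (prod_encode (j, n)))} = B j" for j
    by (auto simp: w_def)
  then have "coded j w = B j" for j
    using assms by (simp add: coded_def infsets_def)
  then show ?thesis by blast
qed

lemma sets_Collect_coordinate:
  "{w \<in> space clopen_borel. P ((w :: nat \<Rightarrow> nat) i)} \<in> sets clopen_borel"
proof -
  have "{w \<in> space clopen_borel. P (w i)} = (\<lambda>w. w i) -` Collect P"
    by auto
  also have "\<dots> \<in> sets clopen_borel"
    by (rule clopen_in_clopen_borel; rule open_vimage closed_vimage)
       (simp_all add: open_discrete closed_def)
  finally show ?thesis .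
qed

lemma measurable_coded: "coded j \<in> clopen_borel \<rightarrow>\<^sub>M infsets_borel"
proof (rule measurable_into_infsets_borel)
  fix n
  have "n \<in> coded j w \<longleftrightarrow> ((\<forall>m. \<exists>i. m < i \<and> odd (w (prod_encode (j, i)))) \<longrightarrow>
      odd (w (prod_encode (j, n))))" for w
    by (auto simp: coded_def Let_def infinite_nat_iff_unbounded)
  then show "{w \<in> space clopen_borel. n \<in> coded j w} \<in> sets clopen_borel"
    by (simp only:) (intro sets.sets_Collect_imp sets.sets_Collect_countable_All
        sets.sets_Collect_countable_Ex sets.sets_Collect_conj sets.sets_Collect_const sets_Collect_coordinate)
qed (use coded_in_infsets in \<open>auto simp: infsets_def\<close>)

theorem theorem2p6:
  fixes \<phi> \<psi> :: "nat set \<Rightarrow> nat set"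
  assumes "\<phi> \<in> infsets \<rightarrow> infsets"
    and "\<psi> \<in> infsets \<rightarrow> infsets"
    and "centered (\<psi> ` infsets)"
    and "\<And>A B. A \<in> infsets \<Longrightarrow> B \<in> infsets \<Longrightarrow> almost_subset A (\<psi> B) \<Longrightarrow> \<not> splits B (\<phi> A)"
  shows "\<not> (\<phi> \<in> infsets_borel \<rightarrow>\<^sub>M infsets_borel \<and> \<psi> \<in> infsets_borel \<rightarrow>\<^sub>M infsets_borel)"
proof
  assume "\<phi> \<in> infsets_borel \<rightarrow>\<^sub>M infsets_borel \<and> \<psi> \<in> infsets_borel \<rightarrow>\<^sub>M infsets_borel"
  then have phi: "\<phi> \<in> infsets_borel \<rightarrow>\<^sub>M infsets_borel" and psi: "\<psi> \<in> infsets_borel \<rightarrow>\<^sub>M infsets_borel"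
    by auto
  have phi_inf: "infinite (\<phi> A)" if "infinite A" for A
    using assms(1) that by (auto simp: infsets_def)
  define F where "F = {K. \<exists>\<G>. finite \<G> \<and> \<G> \<subseteq> infsets \<and> (\<Inter>B\<in>\<G>. \<psi> B) \<subseteq> K}"
  interpret infinite_filter_base F
  proof
    fix K L assume "K \<in> F" "L \<in> F"
    then obtain \<G> \<H> where "finite \<G>" "\<G> \<subseteq> infsets" "(\<Inter>B\<in>\<G>. \<psi> B) \<subseteq> K"
      "finite \<H>" "\<H> \<subseteq> infsets" "(\<Inter>B\<in>\<H>. \<psi> B) \<subseteq> L"
      unfolding F_def by blast
    then show "K \<inter> L \<in> F"
      unfolding F_def by (intro CollectI exI[of _ "\<G> \<union> \<H>"]) auto
  next
    fix K assume "K \<in> F"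
    then obtain \<G> where \<G>: "finite \<G>" "\<G> \<subseteq> infsets" "(\<Inter>B\<in>\<G>. \<psi> B) \<subseteq> K"
      unfolding F_def by blast
    then have "infinite (\<Inter>(\<psi> ` \<G>))"
      using assms(3) unfolding centered_def by blast
    then show "infinite K"
      using \<G>(3) by (rule infinite_super[rotated])
  qed
  define P where "P n = {A \<in> infsets. n \<in> \<phi> A}" for n
  have P_borel: "P n \<in> sets infsets_borel" for n
    using sets_mem_infsets_borel[OF phi] by (simp add: P_def space_infsets_borel)
  obtain T where T_countable: "\<And>n. countable (T n)"
    and T: "\<And>n s G. cond s G \<Longrightarrow>
      meager (P n \<inter> ebox s G) \<longleftrightarrow> (\<forall>(t, L)\<in>T n. \<not> (s \<subseteq> L \<and> t \<subseteq> G))"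
    using meager_ebox_code[OF decided_borel[OF P_borel]] by metis
  \<comment> \<open>Basic members of the filter, parametrised by points of the Baire space. Adding
    \<open>s\<close> makes a condition with stem \<open>s\<close>, and every condition with this
    stem can be shrunk to one of this form.\<close>
  define G where "G s m w = s \<union> (\<Inter>j<m. \<psi> (coded j w))" for s and m :: nat and w
  have cond_G: "cond s (G s m w)" if "finite s" for s m w
  proof -
    have "(\<Inter>B\<in>(\<lambda>j. coded j w) ` {..<m}. \<psi> B) \<subseteq> G s m w"
      by (auto simp: G_def)
    then have "G s m w \<in> F"
      unfolding F_def
      by (intro CollectI exI[of _ "(\<lambda>j. coded j w) ` {..<m}"]) (auto simp: coded_in_infsets)
    then show ?thesis using that by (simp add: cond_def G_def)
  qed
  \<comment> \<open>The coded condition forces \<open>\<phi> A\<close> to miss, from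
    \<open>k\<close> on, the set coded by \<open>x\<close> (if \<open>c\<close> holds) or its
    complement (if not).\<close>
  define Q where "Q s c = {(x :: nat \<Rightarrow> nat, w). \<exists>m k. \<forall>n\<ge>k. even (x n) = c \<longrightarrow>
      meager (P n \<inter> ebox s (G s m w))}" for s c
  define W where "W s c = fst ` Q s c" for s c
  have W_iff: "x \<in> W s c \<longleftrightarrow> (\<exists>w m k. \<forall>n\<ge>k. even (x n) = c \<longrightarrow> meager (P n \<inter> ebox s (G s m w)))"
    for x s c
    unfolding W_def Q_def by (auto simp: image_iff)
  have Q_borel: "Q s c \<in> sets clopen_borel" if "finite s" for s c
  proof -
    have sub: "t \<subseteq> G s m w \<longleftrightarrow> (\<forall>a\<in>t - s. \<forall>j\<in>{..<m}. a \<in> \<psi> (coded j w))" for t m w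
      by (auto simp: G_def)
    \<comment> \<open>Through \<open>T\<close>, meagerness, which quantifies over sequences of sets,
      becomes a statement with countable quantifiers only.\<close>
    have *: "meager (P n \<inter> ebox s (G s m w)) \<longleftrightarrow>
        (\<forall>p\<in>T n. s \<subseteq> snd p \<longrightarrow> \<not> (\<forall>a\<in>fst p - s. \<forall>j\<in>{..<m}. a \<in> \<psi> (coded j w)))" for n m w
      by (simp add: T[OF cond_G[OF that]] sub split_beta)
    have fst: "fst \<in> clopen_borel \<rightarrow>\<^sub>M (clopen_borel :: (nat \<Rightarrow> nat) measure)"
      and snd: "snd \<in> clopen_borel \<rightarrow>\<^sub>M (clopen_borel :: (nat \<Rightarrow> nat) measure)"
      by (intro continuous_on_imp_measurable_clopen_borel continuous_on_fst continuous_on_snd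
          continuous_on_id)+
    have x: "{p \<in> space (clopen_borel :: ((nat \<Rightarrow> nat) \<times> (nat \<Rightarrow> nat)) measure). even (fst p n) = c}
        \<in> sets clopen_borel" for n
      by (rule measurable_sets_Collect[OF fst sets_Collect_coordinate])
    have w: "{p \<in> space (clopen_borel :: ((nat \<Rightarrow> nat) \<times> (nat \<Rightarrow> nat)) measure). a \<in> \<psi> (coded j (snd p))}
        \<in> sets clopen_borel" for a j
      by (rule measurable_sets_Collect[OF snd sets_mem_infsets_borel[OF
            measurable_compose[OF measurable_coded psi]]])
    have "{p \<in> space (clopen_borel :: ((nat \<Rightarrow> nat) \<times> (nat \<Rightarrow> nat)) measure). \<exists>m k. \<forall>n. k \<le> n \<longrightarrow> even (fst p n) = c \<longrightarrow>
        (\<forall>q\<in>T n. s \<subseteq> snd q \<longrightarrow> \<not> (\<forall>a\<in>fst q - s. \<forall>j\<in>{..<m}. a \<in> \<psi> (coded j (snd p))))}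
      \<in> sets clopen_borel"
      by (intro sets.sets_Collect_countable_Ex sets.sets_Collect_countable_All sets.sets_Collect_imp
          sets.sets_Collect_const sets.sets_Collect_neg sets.sets_Collect_countable_All'[OF _ T_countable]
          sets.sets_Collect_countable_Ball x w)
    moreover have "{p \<in> space (clopen_borel :: ((nat \<Rightarrow> nat) \<times> (nat \<Rightarrow> nat)) measure). \<exists>m k. \<forall>n. k \<le> n \<longrightarrow> even (fst p n) = c \<longrightarrow>
        (\<forall>q\<in>T n. s \<subseteq> snd q \<longrightarrow> \<not> (\<forall>a\<in>fst q - s. \<forall>j\<in>{..<m}. a \<in> \<psi> (coded j (snd p))))}
      = Q s c"
      by (simp add: Q_def * case_prod_beta')
    ultimately show ?thesis by simp
  qed
  have W_analytic: "analytic (W s c)" if "finite s" for s c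
    unfolding W_def by (rule analytic_projection[OF clopen_borel_imp_analytic[OF Q_borel[OF that]]])
  \<comment> \<open>The two boxes share the stem \<open>s\<close>, hence meet in a box. Each
    \<open>n\<close> from \<open>l\<close> on is excluded from \<open>\<phi> A\<close> by one of
    them, so for all \<open>A\<close> in that box outside a meager set \<open>\<phi> A\<close> would
    be bounded by \<open>l\<close>.\<close>
  have tail: False if s: "finite s" and x: "x \<in> W s c" "tail_map swap_parity p x \<in> W s c" for s c p x
  proof -
    obtain w m k where 1: "\<forall>n\<ge>k. even (x n) = c \<longrightarrow> meager (P n \<inter> ebox s (G s m w))"
      using x(1) unfolding W_iff by blast
    obtain w' m' k' where 2: "\<forall>n\<ge>k'. even (tail_map swap_parity p x n) = c \<longrightarrow>
        meager (P n \<inter> ebox s (G s m' w'))"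
      using x(2) unfolding W_iff by blast
    define K where "K = G s m w \<inter> G s m' w'"
    have "cond s K"
      using cond_Un_Int[OF cond_G cond_G, of s s m w m' w'] s by (simp add: K_def G_def Int_commute)
    have K: "ebox s K \<subseteq> ebox s (G s m w)" "ebox s K \<subseteq> ebox s (G s m' w')"
      by (auto simp: K_def ebox_def)
    define l where "l = max p (max k k')"
    have "meager (P n \<inter> ebox s K)" if n: "l \<le> n" for n
    proof (cases "even (x n) = c")
      case True
      then have "meager (P n \<inter> ebox s (G s m w))" using 1 n by (simp add: l_def)
      then show ?thesis by (rule meager_subset) (use K in auto)
    next
      case False
      then have "even (tail_map swap_parity p x n) = c"
        using n by (auto simp: tail_map_def l_def even_swap_parity)
      then have "meager (P n \<inter> ebox s (G s m' w'))" using 2 n by (simp add: l_def)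
      then show ?thesis by (rule meager_subset) (use K in auto)
    qed
    then have "meager (\<Union>n\<in>{l..}. P n \<inter> ebox s K)"
      by (intro meager_UN) auto
    moreover have "ebox s K \<subseteq> (\<Union>n\<in>{l..}. P n \<inter> ebox s K)"
    proof
      fix A assume A: "A \<in> ebox s K"
      then have "infinite (\<phi> A)" by (intro phi_inf) (simp add: ebox_def)
      then obtain n where "l \<le> n" "n \<in> \<phi> A"
        unfolding infinite_nat_iff_unbounded_le by blast
      then show "A \<in> (\<Union>n\<in>{l..}. P n \<inter> ebox s K)"
        using A by (auto simp: P_def infsets_def ebox_def)
    qed
    ultimately show False
      using meager_subset baire ebox_in_boxes[OF \<open>cond s K\<close>] by blast
  qed
  have cover: "\<exists>s c. finite s \<and> x \<in> W s c" for x
  proof -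
    \<comment> \<open>Hypothesis (b) speaks of infinite \<open>B\<close>, so a parity class that is
      infinite is chosen.\<close>
    obtain c0 where c0: "infinite {n. even (x n) = c0}"
    proof (cases "finite {n. odd (x n)}")
      case True
      then have "infinite (UNIV - {n. odd (x n)})"
        by (simp add: Diff_infinite_finite)
      also have "UNIV - {n. odd (x n)} = {n. even (x n) = True}" by auto
      finally show thesis by (rule that)
    next
      case False
      then show thesis by (intro that[of False]) simp
    qed
    define B where "B = {n. even (x n) = c0}"
    have B: "B \<in> infsets" using c0 by (simp add: B_def infsets_def)
    then have "\<psi> B \<in> F"
      unfolding F_def by (intro CollectI exI[of _ "{B}"]) auto
    then have cond_B: "cond {} (\<psi> B)" by (simp add: cond_def)
    define Z where "Z = (\<lambda>(c, k). {A \<in> infsets. \<forall>n\<ge>k. even (x n) = c \<longrightarrow> n \<notin> \<phi> A})"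
    have "A \<in> (\<Union>i. Z i)" if A: "A \<in> ebox {} (\<psi> B)" for A
    proof -
      have A': "A \<in> infsets" and "almost_subset A (\<psi> B)"
        using A by (auto simp: ebox_def infsets_def almost_subset_def Diff_eq_empty_iff[THEN iffD2])
      then have "finite (\<phi> A \<inter> B) \<or> finite (\<phi> A - B)"
        using assms(4)[OF _ B] unfolding splits_def by blast
      then obtain k c where "\<forall>n\<ge>k. even (x n) = c \<longrightarrow> n \<notin> \<phi> A"
      proof
        assume "finite (\<phi> A \<inter> B)"
        then obtain k where "\<phi> A \<inter> B \<subseteq> {..<k}" using finite_nat_iff_bounded by blast
        then show thesis by (intro that[of k c0]) (auto simp: B_def)
      next
        assume "finite (\<phi> A - B)"
        then obtain k where "\<phi> A - B \<subseteq> {..<k}" using finite_nat_iff_bounded by blast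
        then show thesis by (intro that[of k "\<not> c0"]) (auto simp: B_def)
      qed
      then show ?thesis using A' by (auto simp: Z_def)
    qed
    then have "ebox {} (\<psi> B) \<subseteq> (\<Union>i. Z i \<inter> ebox {} (\<psi> B))" by auto
    then have "\<not> meager (\<Union>i. Z i \<inter> ebox {} (\<psi> B))"
      using baire[OF ebox_in_boxes[OF cond_B]] meager_subset by blast
    then obtain c k where ck: "\<not> meager (Z (c, k) \<inter> ebox {} (\<psi> B))"
      using meager_UN[of UNIV "\<lambda>i. Z i \<inter> ebox {} (\<psi> B)"] by auto
    have "Z (c, k) = space infsets_borel - (\<Union>n\<in>{n. k \<le> n \<and> even (x n) = c}. P n)"
      by (auto simp: Z_def P_def space_infsets_borel)
    then have "Z (c, k) \<in> sets infsets_borel"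
      using P_borel by (auto intro!: sets.countable_UN')
    \<comment> \<open>Nonmeager improves to comeager in a smaller box, whose stem may be nonempty:
      this is where \<open>s\<close> comes from.\<close>
    then obtain V where "V \<in> boxes" "meager (V - Z (c, k))"
      using ex_comeager_subset[OF decided_borel ebox_in_boxes[OF cond_B] ck] by blast
    then obtain s K where c: "cond s K" and m: "meager (ebox s K - Z (c, k))"
      by (auto elim!: boxesE)
    have "K \<in> F" using c by (simp add: cond_def)
    then obtain \<G> where \<G>: "finite \<G>" "\<G> \<subseteq> infsets" "(\<Inter>B\<in>\<G>. \<psi> B) \<subseteq> K"
      unfolding F_def by blast
    obtain e and m :: nat where e: "\<G> = e ` {i. i < m}"
      using finite_imp_nat_seg_image_inj_on[OF \<G>(1)] by blast
    \<comment> \<open>The finite family is padded with \<open>UNIV\<close> to a full sequence of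
      infinite sets; \<open>G s m w\<close> reads only the entries below \<open>m\<close>.\<close>
    have "(if j < m then e j else UNIV) \<in> infsets" for j
      using \<G>(2) by (auto simp: e infsets_def)
    then obtain w where w: "\<And>j. coded j w = (if j < m then e j else UNIV)"
      using coded_surj[of "\<lambda>j. if j < m then e j else UNIV"] by blast
    have "(\<Inter>j<m. \<psi> (coded j w)) = (\<Inter>B\<in>\<G>. \<psi> B)"
      by (auto simp: e w)
    then have "G s m w \<subseteq> K"
      using \<G>(3) c by (auto simp: G_def cond_def)
    then have "meager (P n \<inter> ebox s (G s m w))" if "n \<ge> k" "even (x n) = c" for n
      using that \<open>meager (ebox s K - Z (c, k))\<close>
      by (elim meager_subset) (auto simp: P_def Z_def ebox_def)
    then have "x \<in> W s c"
      unfolding W_iff by blast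
    then show ?thesis using c by (auto simp: cond_def)
  qed
  have "\<not> cyl.meager UNIV"
    using cyl.baire[OF cyl_in_cyls, of 0 undefined] by (simp add: cyl_def)
  \<comment> \<open>Only the stem and the parity index this cover; \<open>w\<close>,
    \<open>m\<close> and \<open>k\<close> are absorbed into the analytic sets, which keeps it
    countable.\<close>
  moreover have "(\<Union>(s, c)\<in>Collect finite \<times> UNIV. W s c) = UNIV"
    using cover by auto
  ultimately obtain s c where "finite s" "\<not> cyl.meager (W s c)"
    using cyl.meager_UN[of "Collect finite \<times> UNIV" "\<lambda>(s, c). W s c"]
    by (auto simp: countable_Collect_finite)
  then obtain p x where "x \<in> W s c" "tail_map swap_parity p x \<in> W s c"
    using analytic_nonmeager_tail_map[OF W_analytic _ swap_parity_swap_parity] by blast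
  then show False using tail \<open>finite s\<close> by blast
qed

end
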